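(* Let $P$ be a dcpo and let $G$ be a set of preclosure maps on $P$. Then $\mathrm{fix}(G)=\{x\in P : g(x)=x \text{ for every } g\in G\}$ is a closure system in $P$, and the corresponding closure operator $\overline{G}$ on $P$, i.e. the one with $\mathrm{fix}(\overline{G})=\mathrm{fix}(G)$, is the least of all closure operators on $P$ that are above $G$. The closure operator $\overline{G}$ satisfies the induction principle: if a subset $A\subseteq P$ is closed under directed joins and is closed under $G$, then $A$ is closed under $\overline{G}$. Moreover, the obverse induction principle for $\overline{G}$ holds: if a subset $A\subseteq P$ is inaccessible by directed joins and is inversely closed under $G$, then $A$ is inversely closed under $\overline{G}$.
   Context: A subset of a poset is directed if it is nonempty and any two of its elements have an upper bound in it. A dcpo is a poset in which every directed subset has a join (no least element is required). A preclosure map on a poset $P$ is a map $f:P\to P$ that is increasing ($x\le y$ implies $f(x)\le f(y)$) and ascending ($x\le f(x)$ for all $x$). A closure operator on $P$ is an idempotent preclosure map. Maps are ordered pointwise; a closure operator $h$ is above $G$ if $h\ge g$ for every $g\in G$. A closure system in $P$ is the fixpoint set $\mathrm{fix}(\gamma)$ of some closure operator $\gamma$ on $P$; equivalently, a subset $C\subseteq P$ such that for every $x\in P$ the set $\{y\in C: y\ge x\}$ has a least element; $\gamma$ is uniquely determined by $\mathrm{fix}(\gamma)$. For a subset $A\subseteq P$ of a dcpo: $A$ is closed under directed joins if the join of every directed subset of $P$ contained in $A$ belongs to $A$; $A$ is inaccessible by directed joins if every directed subset of $P$ whose join lies in $A$ has some element in $A$. For a set $F$ of maps $P\to P$: $A$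 is closed under $F$ if $f(A)\subseteq A$ for every $f\in F$; $A$ is inversely closed under $F$ if $f^{-1}(A)\subseteq A$ for every $f\in F$. For a single map $f$, "(inversely) closed under $f$" means (inversely) closed under $\{f\}$. *)

theory Defs
  imports Main "HOL-Library.FuncSet" "HOL-Library.Lub_Glb"
begin

text \<open>
  A poset is a subset \<open>P\<close> of an ordered type with the induced order (so \<open>P\<close> may be empty).
  A map \<open>P \<rightarrow> P\<close> is an element of \<open>P \<rightarrow>\<^sub>E P\<close>, so that equality of such
  functions is equality of maps on \<open>P\<close>.
  The join of \<open>D\<close> in \<open>P\<close> is expressed by \<open>isLub P D s\<close>: it is the least among
  the upper bounds of \<open>D\<close> that belong to \<open>P\<close>, which need not be the
  supremum of \<open>D\<close> in the ambient type.
\<close>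

definition directed :: "'a::order set \<Rightarrow> bool" where
  "directed D \<longleftrightarrow> D \<noteq> {} \<and> (\<forall>x\<in>D. \<forall>y\<in>D. \<exists>z\<in>D. x \<le> z \<and> y \<le> z)"

definition dcpo :: "'a::order set \<Rightarrow> bool" where
  "dcpo P \<longleftrightarrow> (\<forall>D\<subseteq>P. directed D \<longrightarrow> (\<exists>s. isLub P D s))"

definition preclosure_map :: "'a::order set \<Rightarrow> ('a \<Rightarrow> 'a) \<Rightarrow> bool" where
  "preclosure_map P f \<longleftrightarrow> f \<in> P \<rightarrow>\<^sub>E P \<and> mono_on P f \<and> (\<forall>x\<in>P. x \<le> f x)"

definition closure_operator :: "'a::order set \<Rightarrow> ('a \<Rightarrow> 'a) \<Rightarrow> bool" where
  "closure_operator P f \<longleftrightarrow> preclosure_map P f \<and> (\<forall>x\<in>P. f (f x) = f x)"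

definition map_le :: "'a::order set \<Rightarrow> ('a \<Rightarrow> 'a) \<Rightarrow> ('a \<Rightarrow> 'a) \<Rightarrow> bool" where
  "map_le P f h \<longleftrightarrow> (\<forall>x\<in>P. f x \<le> h x)"

definition above :: "'a::order set \<Rightarrow> ('a \<Rightarrow> 'a) set \<Rightarrow> ('a \<Rightarrow> 'a) \<Rightarrow> bool" where
  "above P G h \<longleftrightarrow> (\<forall>g\<in>G. map_le P g h)"

definition fixpoints :: "'a::order set \<Rightarrow> ('a \<Rightarrow> 'a) set \<Rightarrow> 'a set" where
  "fixpoints P G = {x \<in> P. \<forall>g\<in>G. g x = x}"

definition closure_system :: "'a::order set \<Rightarrow> 'a set \<Rightarrow> bool" where
  "closure_system P C \<longleftrightarrow> (\<exists>h. closure_operator P h \<and> fixpoints P {h} = C)"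

definition closure_operator_of :: "'a::order set \<Rightarrow> 'a set \<Rightarrow> 'a \<Rightarrow> 'a" where
  "closure_operator_of P C = (THE h. closure_operator P h \<and> fixpoints P {h} = C)"

definition least_closure_operator_above ::
    "'a::order set \<Rightarrow> ('a \<Rightarrow> 'a) set \<Rightarrow> ('a \<Rightarrow> 'a) \<Rightarrow> bool" where
  "least_closure_operator_above P G h \<longleftrightarrow>
     closure_operator P h \<and> above P G h \<and>
     (\<forall>k. closure_operator P k \<and> above P G k \<longrightarrow> map_le P h k)"

definition closed_under_directed_joins :: "'a::order set \<Rightarrow> 'a set \<Rightarrow> bool" where
  "closed_under_directed_joins P A \<longleftrightarrow>
     (\<forall>D s. D \<subseteq> P \<and> directed D \<and> D \<subseteq> A \<and> isLub P D s \<longrightarrow> s \<in> A)"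

definition inaccessible_by_directed_joins :: "'a::order set \<Rightarrow> 'a set \<Rightarrow> bool" where
  "inaccessible_by_directed_joins P A \<longleftrightarrow>
     (\<forall>D s. D \<subseteq> P \<and> directed D \<and> isLub P D s \<and> s \<in> A \<longrightarrow> (\<exists>d\<in>D. d \<in> A))"

definition closed_under :: "'a set \<Rightarrow> ('a \<Rightarrow> 'a) set \<Rightarrow> bool" where
  "closed_under A F \<longleftrightarrow> (\<forall>f\<in>F. f ` A \<subseteq> A)"

text \<open>The preimage of \<open>A\<close> under a map on \<open>P\<close> is taken within \<open>P\<close>.\<close>

definition inversely_closed_under :: "'a set \<Rightarrow> 'a set \<Rightarrow> ('a \<Rightarrow> 'a) set \<Rightarrow> bool" where
  "inversely_closed_under P A F \<longleftrightarrow> (\<forall>f\<in>F. f -` A \<inter> P \<subseteq> A)"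

text \<open>The description in \<open>closure_operator_of\<close> is definite for every closure system.\<close>

lemma closure_operator_le:
  assumes f: "closure_operator P f" and h: "closure_operator P h"
    and eq: "fixpoints P {f} = fixpoints P {h}" and x: "x \<in> P"
  shows "f x \<le> h x"
proof -
  have hx: "h x \<in> P" "x \<le> h x"
    using h x by (auto simp: closure_operator_def preclosure_map_def)
  have "h x \<in> fixpoints P {h}"
    using h x hx by (simp add: closure_operator_def fixpoints_def)
  then have "f (h x) = h x"
    unfolding eq[symmetric] by (simp add: fixpoints_def)
  moreover have "f x \<le> f (h x)"
    using f x hx by (auto simp: closure_operator_def preclosure_map_def dest: mono_onD)
  ultimately show ?thesis by simp
qed

lemma closure_system_iff_ex1:
  "closure_system P C \<longleftrightarrow> (\<exists>!h. closure_operator P h \<and> fixpoints P {h} = C)"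
proof -
  have "f = h"
    if "closure_operator P f \<and> fixpoints P {f} = C"
      and "closure_operator P h \<and> fixpoints P {h} = C" for f h
  proof (rule PiE_ext)
    show "f \<in> P \<rightarrow>\<^sub>E P" "h \<in> P \<rightarrow>\<^sub>E P"
      using that by (auto simp: closure_operator_def preclosure_map_def)
    show "f x = h x" if "x \<in> P" for x
      using closure_operator_le[of P f h x] closure_operator_le[of P h f x]
        \<open>x \<in> P\<close> \<open>closure_operator P f \<and> fixpoints P {f} = C\<close>
        \<open>closure_operator P h \<and> fixpoints P {h} = C\<close>
      by (simp add: order_antisym)
  qed
  then show ?thesis
    unfolding closure_system_def by blast
qed

end

theory Submission imports Defs begin

text \<open>
  This is Pataraia's argument. Consider the preclosure maps that preserve every subset of \<open>P\<close>
  closed under directed joins and under \<open>G\<close>. They are closed under composition, and since they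
  are ascending and increasing, \<open>f \<circ> g\<close> is above both \<open>f\<close> and \<open>g\<close>; so they form a directed
  set, and their pointwise join \<open>t\<close> is the greatest of them. As \<open>t \<circ> t\<close> and \<open>g \<circ> t\<close> are again
  such maps, \<open>t\<close> is idempotent and takes values in the common fixpoints of \<open>G\<close>; it fixes such a
  fixpoint \<open>x\<close> because it preserves \<open>{x}\<close>. The obverse induction principle is the induction
  principle for the complement.
\<close>

lemma isLub_iff:
  "isLub P D s \<longleftrightarrow>
    s \<in> P \<and> (\<forall>d\<in>D. d \<le> s) \<and> (\<forall>u\<in>P. (\<forall>d\<in>D. d \<le> u) \<longrightarrow> s \<le> u)"
  by (auto simp: isLub_def leastP_def isUb_def setle_def setge_def)

lemma preclosure_mapD:
  assumes "preclosure_map P f"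
  shows "x \<in> P \<Longrightarrow> f x \<in> P" and "x \<in> P \<Longrightarrow> x \<le> f x"
    and "x \<in> P \<Longrightarrow> y \<in> P \<Longrightarrow> x \<le> y \<Longrightarrow> f x \<le> f y"
  using assms by (auto simp: preclosure_map_def dest: mono_onD)

lemma preclosure_mapI:
  assumes "f \<in> extensional P" and "\<And>x. x \<in> P \<Longrightarrow> f x \<in> P" and "\<And>x. x \<in> P \<Longrightarrow> x \<le> f x"
    and "\<And>x y. x \<in> P \<Longrightarrow> y \<in> P \<Longrightarrow> x \<le> y \<Longrightarrow> f x \<le> f y"
  shows "preclosure_map P f"
  using assms by (auto simp: preclosure_map_def PiE_def intro: mono_onI)

lemma preclosure_map_compose:
  assumes "preclosure_map P f" and "preclosure_map P g"
  shows "preclosure_map P (compose P f g)"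
proof (rule preclosure_mapI)
  show "x \<le> compose P f g x" if "x \<in> P" for x
    using that preclosure_mapD[OF assms(1)] preclosure_mapD[OF assms(2)]
    by (simp add: compose_eq) (meson order_trans)
qed (auto simp: compose_eq preclosure_mapD[OF assms(1)] preclosure_mapD[OF assms(2)])

text \<open>The induction principle is built into membership, so it holds at once for the greatest
  element. Quantifying over all such \<open>A\<close> takes the place of a transfinite iteration of
  \<open>G\<close>.\<close>

definition preserving_maps :: "'a::order set \<Rightarrow> ('a \<Rightarrow> 'a) set \<Rightarrow> ('a \<Rightarrow> 'a) set" where
  "preserving_maps P G = {f. preclosure_map P f \<and>
     (\<forall>A\<subseteq>P. closed_under_directed_joins P A \<and> closed_under A G \<longrightarrow> closed_under A {f})}"

lemma preserving_maps_preclosure_map: "f \<in> preserving_maps P G \<Longrightarrow> preclosure_map P f"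
  by (simp add: preserving_maps_def)

lemma closed_underD: "closed_under A F \<Longrightarrow> x \<in> A \<Longrightarrow> f \<in> F \<Longrightarrow> f x \<in> A"
  by (auto simp: closed_under_def)

lemma preserving_mapsD:
  assumes "f \<in> preserving_maps P G" and "A \<subseteq> P" and "closed_under_directed_joins P A"
    and "closed_under A G" and "x \<in> A"
  shows "f x \<in> A"
proof -
  have "closed_under A {f}"
    using assms(1-4) by (simp add: preserving_maps_def)
  then show ?thesis
    using assms(5) by (rule closed_underD) simp
qed

lemma preserving_mapsI:
  assumes "preclosure_map P f"
    and "\<And>A x. \<lbrakk>A \<subseteq> P; closed_under_directed_joins P A; closed_under A G; x \<in> A\<rbrakk> \<Longrightarrow> f x \<in> A"
  shows "f \<in> preserving_maps P G"
proof -
  have "closed_under A {f}"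
    if "A \<subseteq> P" "closed_under_directed_joins P A" "closed_under A G" for A
    using assms(2)[OF that] by (auto simp: closed_under_def)
  with assms(1) show ?thesis by (simp add: preserving_maps_def)
qed

text \<open>This serves twice: it makes the family of maps nonempty, as directedness demands, and it
  makes the pointwise join ascending.\<close>

lemma preserving_maps_id: "restrict (\<lambda>x. x) P \<in> preserving_maps P G"
  by (rule preserving_mapsI) (auto intro!: preclosure_mapI)

lemma preserving_maps_superset: "\<forall>g\<in>G. preclosure_map P g \<Longrightarrow> G \<subseteq> preserving_maps P G"
  by (auto intro!: preserving_mapsI intro: closed_underD)

lemma preserving_maps_compose:
  assumes "f \<in> preserving_maps P G" and "g \<in> preserving_maps P G"
  shows "compose P f g \<in> preserving_maps P G"
proof (rule preserving_mapsI)
  show "preclosure_map P (compose P f g)"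
    using assms by (intro preclosure_map_compose preserving_maps_preclosure_map)
  show "compose P f g x \<in> A" if A: "A \<subseteq> P" "closed_under_directed_joins P A"
    "closed_under A G" "x \<in> A" for A x
    using A preserving_mapsD[OF assms(1) A(1-3) preserving_mapsD[OF assms(2) A]]
    by (simp add: compose_eq subsetD)
qed

lemma directed_preserving_maps_image:
  assumes "x \<in> P"
  shows "directed ((\<lambda>f. f x) ` preserving_maps P G)"
proof -
  \<comment> \<open>For \<open>f (g x)\<close>, the first bound applies the increasing
    \<open>f\<close> to \<open>x \<le> g x\<close>; the second is that \<open>f\<close> is ascending
    at \<open>g x\<close>.\<close>
  have "f x \<le> compose P f g x \<and> g x \<le> compose P f g x"
    if "f \<in> preserving_maps P G" and "g \<in> preserving_maps P G" for f g
    using that assms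
    by (simp add: compose_eq preclosure_mapD[OF preserving_maps_preclosure_map])
  then have "\<exists>h\<in>preserving_maps P G. f x \<le> h x \<and> g x \<le> h x"
    if "f \<in> preserving_maps P G" and "g \<in> preserving_maps P G" for f g
    using that preserving_maps_compose[OF that] by blast
  moreover have "preserving_maps P G \<noteq> {}"
    using preserving_maps_id by blast
  ultimately show ?thesis
    by (simp add: directed_def)
qed

lemma greatest_preserving_map:
  assumes "dcpo P"
  obtains t where "t \<in> preserving_maps P G" and "\<And>f. f \<in> preserving_maps P G \<Longrightarrow> map_le P f t"
proof -
  let ?M = "preserving_maps P G"
  let ?V = "\<lambda>x. (\<lambda>f. f x) ` ?M"
  note M = preclosure_mapD[OF preserving_maps_preclosure_map]
  \<comment> \<open>\<open>SOME\<close> picks the join that the dcpo property supplies for the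
    directed set \<open>?V x\<close>; \<open>restrict\<close> makes \<open>t\<close> a map on
    \<open>P\<close>.\<close>
  define t where "t = restrict (\<lambda>x. SOME s. isLub P (?V x) s) P"
  have sub: "?V x \<subseteq> P" if "x \<in> P" for x
    using that M(1) by blast
  have lub: "isLub P (?V x) (t x)" if "x \<in> P" for x
    using assms directed_preserving_maps_image[OF that, of G] sub[OF that] that
    by (auto simp: t_def dcpo_def intro: someI_ex)
  have above: "f x \<le> t x" if "f \<in> ?M" "x \<in> P" for f x
    using lub[OF that(2)] that(1) by (auto simp: isLub_iff)
  have tP: "t x \<in> P" if "x \<in> P" for x
    using lub[OF that] by (simp add: isLub_iff)
  have "preclosure_map P t"
  proof (rule preclosure_mapI)
    show "t \<in> extensional P" by (simp add: t_def)
    show "t x \<in> P" if "x \<in> P" for x using tP that .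
    show "x \<le> t x" if "x \<in> P" for x
      using above[OF preserving_maps_id that] that by simp
    show "t x \<le> t y" if "x \<in> P" "y \<in> P" "x \<le> y" for x y
    proof -
      \<comment> \<open>Since \<open>f x \<le> f y \<le> t y\<close>, the element \<open>t y\<close>
        is an upper bound of \<open>?V x\<close>, hence above its join \<open>t x\<close>.\<close>
      have "f x \<le> t y" if "f \<in> ?M" for f
        using M(3)[OF that \<open>x \<in> P\<close> \<open>y \<in> P\<close> \<open>x \<le> y\<close>] above[OF that \<open>y \<in> P\<close>] by (rule order_trans)
      then show ?thesis
        using lub[OF \<open>x \<in> P\<close>] tP[OF \<open>y \<in> P\<close>] by (auto simp: isLub_iff)
    qed
  qed
  then have "t \<in> ?M"
  proof (rule preserving_mapsI)
    fix A x
    assume A: "A \<subseteq> P" "closed_under_directed_joins P A" "closed_under A G" "x \<in> A"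
    then have "x \<in> P" by blast
    \<comment> \<open>All values at \<open>x\<close> stay in \<open>A\<close>, so \<open>t x\<close>
      is the join of a directed subset of \<open>A\<close>.\<close>
    moreover have "?V x \<subseteq> A"
      using preserving_mapsD[OF _ A] by blast
    ultimately show "t x \<in> A"
      using A(2) sub[of x] directed_preserving_maps_image[of x P G] lub[of x]
      unfolding closed_under_directed_joins_def by blast
  qed
  then show thesis
    using that above by (simp add: map_le_def)
qed

text \<open>A directed set is nonempty, so one contained in \<open>{x}\<close> equals
  \<open>{x}\<close>, and its join can only be \<open>x\<close>.\<close>

lemma closed_under_directed_joins_singleton:
  "closed_under_directed_joins P {x}"
  unfolding closed_under_directed_joins_def
proof (intro allI impI)
  fix D s
  assume D: "D \<subseteq> P \<and> directed D \<and> D \<subseteq> {x} \<and> isLub P D s"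
  then have "D = {x}" by (auto simp: directed_def)
  with D show "s \<in> {x}" by (auto simp: isLub_iff intro: order_antisym)
qed

lemma preserving_maps_fixpoint:
  assumes "f \<in> preserving_maps P G" and "x \<in> fixpoints P G"
  shows "f x = x"
  using preserving_mapsD[OF assms(1) _ closed_under_directed_joins_singleton[of P x], of x] assms(2)
  by (simp add: fixpoints_def closed_under_def)

text \<open>If the join of a directed set lay in \<open>A\<close>, inaccessibility would put one of
  its elements in \<open>A\<close>.\<close>

lemma closed_under_directed_joins_Compl:
  assumes "inaccessible_by_directed_joins P A"
  shows "closed_under_directed_joins P (P - A)"
  unfolding closed_under_directed_joins_def
proof (intro allI impI)
  fix D s
  assume D: "D \<subseteq> P \<and> directed D \<and> D \<subseteq> P - A \<and> isLub P D s"
  then have "s \<notin> A"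
    using assms unfolding inaccessible_by_directed_joins_def by blast
  with D show "s \<in> P - A" by (simp add: isLub_iff)
qed

text \<open>This is contraposition; since \<open>f\<close> maps \<open>P\<close> into itself, a
  value outside \<open>A\<close> lies in \<open>P - A\<close>. The set \<open>F\<close> is arbitrary
  because the equivalence is applied both to \<open>G\<close> and to the closure operator.\<close>

lemma closed_under_Compl_iff:
  assumes "\<forall>f\<in>F. f ` P \<subseteq> P"
  shows "closed_under (P - A) F \<longleftrightarrow> inversely_closed_under P A F"
  unfolding closed_under_def inversely_closed_under_def
proof (rule ball_cong[OF refl])
  fix f assume "f \<in> F"
  then have "\<forall>x\<in>P. f x \<in> P" using assms by blast
  then show "f ` (P - A) \<subseteq> P - A \<longleftrightarrow> f -` A \<inter> P \<subseteq> A" by auto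
qed

text \<open>The chain \<open>g (k x) \<le> k (k x) = k x \<le> g (k x)\<close> collapses to
  equalities.\<close>

lemma closure_operator_above_fixpoint:
  assumes "closure_operator P k" and "above P G k" and "\<forall>g\<in>G. preclosure_map P g" and "x \<in> P"
  shows "k x \<in> fixpoints P G"
proof -
  have kx: "k x \<in> P" "k (k x) = k x"
    using assms preclosure_mapD(1)[of P k] by (auto simp: closure_operator_def)
  have "g (k x) = k x" if "g \<in> G" for g
  proof (rule order_antisym)
    show "g (k x) \<le> k x"
      using assms(2) that kx by (fastforce simp: above_def map_le_def)
    show "k x \<le> g (k x)"
      using assms(3) that kx(1) preclosure_mapD(2) by blast
  qed
  with kx show ?thesis by (simp add: fixpoints_def)
qed

lemma greatest_preserving_map_closure_operator:
  assumes G: "\<forall>g\<in>G. preclosure_map P g" and t: "t \<in> preserving_maps P G"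
    and greatest: "\<And>f. f \<in> preserving_maps P G \<Longrightarrow> map_le P f t"
  shows "closure_operator P t" and "fixpoints P {t} = fixpoints P G"
    and "least_closure_operator_above P G t"
proof -
  note T = preclosure_mapD[OF preserving_maps_preclosure_map[OF t]]
  \<comment> \<open>The composite of \<open>f\<close> with \<open>t\<close> is again a preserving
    map, hence below \<open>t\<close>. Taking \<open>f = t\<close> gives idempotence;
    \<open>f \<in> G\<close> gives fixpoints of \<open>G\<close>.\<close>
  have absorb: "f (t x) = t x" if "f \<in> preserving_maps P G" "x \<in> P" for f x
  proof (rule order_antisym)
    show "f (t x) \<le> t x"
      using greatest[OF preserving_maps_compose[OF that(1) t]] that(2)
      by (simp add: map_le_def compose_eq)
    show "t x \<le> f (t x)"
      using preclosure_mapD(2)[OF preserving_maps_preclosure_map[OF that(1)] T(1)] that(2) .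
  qed
  show cl: "closure_operator P t"
    using preserving_maps_preclosure_map[OF t] absorb[OF t] by (simp add: closure_operator_def)
  have "x \<in> fixpoints P G" if "x \<in> fixpoints P {t}" for x
  proof -
    have x: "x \<in> P" "t x = x" using that by (auto simp: fixpoints_def)
    have "g x = x" if "g \<in> G" for g
      using absorb[of g x] preserving_maps_superset[OF G] that x by auto
    with x show ?thesis by (simp add: fixpoints_def)
  qed
  moreover have "x \<in> fixpoints P {t}" if "x \<in> fixpoints P G" for x
    using preserving_maps_fixpoint[OF t that] that by (simp add: fixpoints_def)
  ultimately show "fixpoints P {t} = fixpoints P G" by blast
  \<comment> \<open>As \<open>k x\<close> is a fixpoint of \<open>G\<close>, it is fixed by
    \<open>t\<close>, so \<open>t x \<le> t (k x) = k x\<close>.\<close>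
  have "map_le P t k" if k: "closure_operator P k" "above P G k" for k
    unfolding map_le_def
  proof
    fix x assume x: "x \<in> P"
    have "x \<le> k x" "k x \<in> P"
      using k(1) x preclosure_mapD by (auto simp: closure_operator_def)
    then have "t x \<le> t (k x)" using T(3) x by blast
    also have "t (k x) = k x"
      using preserving_maps_fixpoint[OF t closure_operator_above_fixpoint[OF k G x]] .
    finally show "t x \<le> k x" .
  qed
  moreover have "above P G t"
    using greatest preserving_maps_superset[OF G] by (auto simp: above_def)
  ultimately show "least_closure_operator_above P G t"
    using cl by (simp add: least_closure_operator_above_def)
qed

text \<open>A closure operator is determined by its fixpoints, so the definite description denotes
  any operator found with the right ones.\<close>

lemma closure_operator_of_eqI:
  assumes "closure_operator P t" and "fixpoints P {t} = C"
  shows "closure_operator_of P C = t"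
  using assms closure_system_iff_ex1[of P C]
  unfolding closure_operator_of_def closure_system_def by (intro the1_equality) auto

theorem theorem3p1:
  fixes P :: "'a::order set" and G :: "('a \<Rightarrow> 'a) set"
  assumes "dcpo P"
    and "\<forall>g\<in>G. preclosure_map P g"
  shows "closure_system P (fixpoints P G) \<and>
    (let Gbar = closure_operator_of P (fixpoints P G) in
      closure_operator P Gbar \<and> fixpoints P {Gbar} = fixpoints P G \<and>
      least_closure_operator_above P G Gbar \<and>
      (\<forall>A\<subseteq>P. closed_under_directed_joins P A \<and> closed_under A G
         \<longrightarrow> closed_under A {Gbar}) \<and>
      (\<forall>A\<subseteq>P. inaccessible_by_directed_joins P A \<and> inversely_closed_under P A G
         \<longrightarrow> inversely_closed_under P A {Gbar}))"
proof -
  obtain t where t: "t \<in> preserving_maps P G"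
    and greatest: "\<And>f. f \<in> preserving_maps P G \<Longrightarrow> map_le P f t"
    using greatest_preserving_map[OF assms(1)] by blast
  note cl = greatest_preserving_map_closure_operator[OF assms(2) t greatest]
  have induct: "closed_under A {t}"
    if "A \<subseteq> P" "closed_under_directed_joins P A" "closed_under A G" for A
    using t that by (simp add: preserving_maps_def)
  have obverse: "inversely_closed_under P A {t}"
    if "inaccessible_by_directed_joins P A" "inversely_closed_under P A G" for A
  proof -
    have "\<forall>f\<in>G. f ` P \<subseteq> P" "\<forall>f\<in>{t}. f ` P \<subseteq> P"
      using assms(2) preserving_maps_preclosure_map[OF t] by (auto dest: preclosure_mapD(1))
    \<comment> \<open>Induction is applied to \<open>P - A\<close>, and the equivalence for
      complements translates both its hypothesis on \<open>G\<close> and its conclusion on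
      \<open>t\<close>.\<close>
    then show ?thesis
      using induct[of "P - A"] that closed_under_directed_joins_Compl[of P A]
      by (simp add: closed_under_Compl_iff)
  qed
  have "closure_system P (fixpoints P G)"
    using cl(1,2) by (auto simp: closure_system_def)
  then show ?thesis
    using cl induct obverse by (simp add: closure_operator_of_eqI[OF cl(1,2)])
qed

end
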